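(* Let $|\psi_{ABC}\rangle\in\mathbb{C}^2\otimes\mathbb{C}^2\otimes\mathbb{C}^2$ be a pure three-qubit state (a unit vector). Then each of the $4\times4$ real matrices $\Gamma_{AB},\Gamma_{BC},\Gamma_{AC}$ has at most two distinct eigenvalues. Explicitly, if $$|\psi_{ABC}\rangle=\lambda_0|0,0,0\rangle+\lambda_1e^{i\phi}|1,0,0\rangle+\lambda_2|1,0,1\rangle+\lambda_3|1,1,0\rangle+\lambda_4|1,1,1\rangle$$ with real $\lambda_0,\dots,\lambda_4\ge0$, $\sum_{k=0}^4\lambda_k^2=1$ and $0\le\phi\le\pi$, and $\Delta=|\lambda_1\lambda_4e^{i\phi}-\lambda_2\lambda_3|^2$, then the eigenvalues $\mu_0^{ij},\mu_1^{ij},\mu_2^{ij},\mu_3^{ij}$ of $\Gamma_{ij}$, listed with multiplicity, are $$\mu_0^{AB}=\mu_1^{AB}=4\lambda_0^2(\lambda_3^2+\lambda_4^2),\qquad \mu_2^{AB}=\mu_3^{AB}=4\lambda_0^2\lambda_3^2,$$ $$\mu_0^{BC}=\mu_1^{BC}=4(\Delta+\lambda_0^2\lambda_4^2),\qquad \mu_2^{BC}=\mu_3^{BC}=4\Delta,$$ $$\mu_0^{AC}=\mu_1^{AC}=4\lambda_0^2(\lambda_2^2+\lambda_4^2),\qquad \mu_2^{AC}=\mu_3^{AC}=4\lambda_0^2\lambda_2^2.$$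
   Context: Here $|i,j,k\rangle$ is the computational basis vector of $\mathbb{C}^2\otimes\mathbb{C}^2\otimes\mathbb{C}^2$ with qubits ordered $A,B,C$. By a known result of Acín et al., every pure three-qubit state can be brought to the displayed canonical form by local unitary transformations. Reduced states: $\rho_{AB}=\mathrm{Tr}_C|\psi_{ABC}\rangle\langle\psi_{ABC}|$, $\rho_{BC}=\mathrm{Tr}_A|\psi_{ABC}\rangle\langle\psi_{ABC}|$, $\rho_{AC}=\mathrm{Tr}_B|\psi_{ABC}\rangle\langle\psi_{ABC}|$. Let $\sigma_0=I_2$ and let $\sigma_1=\begin{pmatrix}0&1\\1&0\end{pmatrix}$, $\sigma_2=\begin{pmatrix}0&-i\\ i&0\end{pmatrix}$, $\sigma_3=\begin{pmatrix}1&0\\0&-1\end{pmatrix}$ be the Pauli matrices. For $ij\in\{AB,BC,AC\}$, $\Lambda_{ij}$ is the $4\times4$ real matrix with entries $(\Lambda_{ij})_{\alpha\beta}=\mathrm{Tr}[\rho_{ij}(\sigma_\alpha\otimes\sigma_\beta)]$, $\alpha,\beta=0,1,2,3$, and $\Gamma_{ij}=G\,\Lambda_{ij}\,G\,\Lambda_{ij}^T$ with $G=\mathrm{diag}(1,-1,-1,-1)$. *)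

theory Defs
  imports Complex_Main "Jordan_Normal_Form.Spectral_Radius"
begin

text \<open>
  Three-qubit vectors are complex vectors of dimension 8 and operators on them are
  8 x 8 matrices; the basis vector |a,b,c> sits at the index with binary digits a, b, c
  (and likewise two-qubit indices are 2 * a + b).  This is the ordering for which the tensor
  product of matrices is the Kronecker product below.
\<close>

definition idx3 :: "nat \<Rightarrow> nat \<Rightarrow> nat \<Rightarrow> nat" where
  "idx3 a b c = 4 * a + 2 * b + c"

definition ket3 :: "nat \<Rightarrow> nat \<Rightarrow> nat \<Rightarrow> complex vec" where
  "ket3 a b c = unit_vec 8 (idx3 a b c)"

definition pure_state3 :: "complex vec \<Rightarrow> bool" where
  "pure_state3 \<psi> \<longleftrightarrow> \<psi> \<in> carrier_vec 8 \<and> \<psi> \<bullet>c \<psi> = 1"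

definition ket_bra :: "complex vec \<Rightarrow> complex mat" where
  "ket_bra \<psi> = mat (dim_vec \<psi>) (dim_vec \<psi>) (\<lambda>(i, j). \<psi> $ i * cnj (\<psi> $ j))"

definition kron :: "'a::times mat \<Rightarrow> 'a mat \<Rightarrow> 'a mat" where
  "kron A B = mat (dim_row A * dim_row B) (dim_col A * dim_col B)
     (\<lambda>(i, j). A $$ (i div dim_row B, j div dim_col B) * B $$ (i mod dim_row B, j mod dim_col B))"

definition mtrace :: "'a::comm_monoid_add mat \<Rightarrow> 'a" where
  "mtrace A = (\<Sum>i<dim_row A. A $$ (i, i))"

definition ptrace_A :: "complex mat \<Rightarrow> complex mat" where
  "ptrace_A \<rho> = mat 4 4 (\<lambda>(i, j).
     \<Sum>a<2. \<rho> $$ (idx3 a (i div 2) (i mod 2), idx3 a (j div 2) (j mod 2)))"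

definition ptrace_B :: "complex mat \<Rightarrow> complex mat" where
  "ptrace_B \<rho> = mat 4 4 (\<lambda>(i, j).
     \<Sum>b<2. \<rho> $$ (idx3 (i div 2) b (i mod 2), idx3 (j div 2) b (j mod 2)))"

definition ptrace_C :: "complex mat \<Rightarrow> complex mat" where
  "ptrace_C \<rho> = mat 4 4 (\<lambda>(i, j).
     \<Sum>c<2. \<rho> $$ (idx3 (i div 2) (i mod 2) c, idx3 (j div 2) (j mod 2) c))"

definition rho_AB :: "complex vec \<Rightarrow> complex mat" where
  "rho_AB \<psi> = ptrace_C (ket_bra \<psi>)"

definition rho_BC :: "complex vec \<Rightarrow> complex mat" where
  "rho_BC \<psi> = ptrace_A (ket_bra \<psi>)"

definition rho_AC :: "complex vec \<Rightarrow> complex mat" where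
  "rho_AC \<psi> = ptrace_B (ket_bra \<psi>)"

definition pauli :: "nat \<Rightarrow> complex mat" where
  "pauli \<alpha> =
     [1\<^sub>m 2,
      mat_of_rows_list 2 [[0, 1], [1, 0]],
      mat_of_rows_list 2 [[0, - \<i>], [\<i>, 0]],
      mat_of_rows_list 2 [[1, 0], [0, - 1]]] ! \<alpha>"

text \<open>
  The trace is a complex number, real whenever the density matrix is Hermitian; hence the
  real part loses nothing on the reduced states (see \<open>Lambda_mat_is_trace\<close> below).
\<close>

definition Lambda_mat :: "complex mat \<Rightarrow> real mat" where
  "Lambda_mat \<rho> = mat 4 4 (\<lambda>(\<alpha>, \<beta>). Re (mtrace (\<rho> * kron (pauli \<alpha>) (pauli \<beta>))))"

definition G_mat :: "real mat" where
  "G_mat = mat_diag 4 (\<lambda>i. if i = 0 then 1 else - 1)"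

definition Gamma_mat :: "complex mat \<Rightarrow> real mat" where
  "Gamma_mat \<rho> = G_mat * Lambda_mat \<rho> * G_mat * transpose_mat (Lambda_mat \<rho>)"

text \<open>Algebraic multiplicity: the matrix need not be diagonalizable.\<close>

definition eigenvalues_with_mult :: "'a::comm_ring_1 mat \<Rightarrow> 'a list \<Rightarrow> bool" where
  "eigenvalues_with_mult A \<mu>s \<longleftrightarrow> char_poly A = (\<Prod>\<mu>\<leftarrow>\<mu>s. [:- \<mu>, 1:])"

definition canonical_state :: "(nat \<Rightarrow> real) \<Rightarrow> real \<Rightarrow> complex vec" where
  "canonical_state l \<phi> =
     complex_of_real (l 0) \<cdot>\<^sub>v ket3 0 0 0
   + (complex_of_real (l 1) * exp (\<i> * complex_of_real \<phi>)) \<cdot>\<^sub>v ket3 1 0 0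
   + complex_of_real (l 2) \<cdot>\<^sub>v ket3 1 0 1
   + complex_of_real (l 3) \<cdot>\<^sub>v ket3 1 1 0
   + complex_of_real (l 4) \<cdot>\<^sub>v ket3 1 1 1"

definition Delta :: "(nat \<Rightarrow> real) \<Rightarrow> real \<Rightarrow> real" where
  "Delta l \<phi> = (cmod (complex_of_real (l 1 * l 4) * exp (\<i> * complex_of_real \<phi>)
                        - complex_of_real (l 2 * l 3)))\<^sup>2"

lemma mtrace_mult_real:
  assumes "A \<in> carrier_mat n n" "B \<in> carrier_mat n n"
    and A: "\<And>i j. i < n \<Longrightarrow> j < n \<Longrightarrow> cnj (A $$ (i, j)) = A $$ (j, i)"
    and B: "\<And>i j. i < n \<Longrightarrow> j < n \<Longrightarrow> cnj (B $$ (i, j)) = B $$ (j, i)"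
  shows "mtrace (A * B) \<in> \<real>"
proof -
  have e: "mtrace (A * B) = (\<Sum>i<n. \<Sum>j<n. A $$ (i, j) * B $$ (j, i))"
    using assms(1,2) by (simp add: mtrace_def scalar_prod_def lessThan_atLeast0)
  have "cnj (mtrace (A * B)) = (\<Sum>i<n. \<Sum>j<n. A $$ (j, i) * B $$ (i, j))"
    unfolding e by (simp add: A B)
  also have "\<dots> = mtrace (A * B)"
    unfolding e by (rule sum.swap)
  finally show ?thesis
    by (simp add: Reals_cnj_iff)
qed

lemma pauli_carrier: "\<alpha> < 4 \<Longrightarrow> pauli \<alpha> \<in> carrier_mat 2 2"
  by (auto simp: pauli_def mat_of_rows_list_def numeral_eq_Suc less_Suc_eq)

lemma pauli_hermitian:
  "\<alpha> < 4 \<Longrightarrow> i < 2 \<Longrightarrow> j < 2 \<Longrightarrow> cnj (pauli \<alpha> $$ (i, j)) = pauli \<alpha> $$ (j, i)"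
  by (auto simp: pauli_def mat_of_rows_list_def numeral_eq_Suc less_Suc_eq)

lemma rho_hermitian:
  assumes "\<psi> \<in> carrier_vec 8" "\<rho> \<in> {rho_AB \<psi>, rho_BC \<psi>, rho_AC \<psi>}" "i < 4" "j < 4"
  shows "cnj (\<rho> $$ (i, j)) = \<rho> $$ (j, i)"
proof -
  have k: "cnj (ket_bra \<psi> $$ (p, q)) = ket_bra \<psi> $$ (q, p)" if "p < 8" "q < 8" for p q
    using that assms(1) by (simp add: ket_bra_def)
  have "idx3 a b c < 8" if "a < 2" "b < 2" "c < 2" for a b c
    using that by (simp add: idx3_def)
  moreover have "i div 2 < 2" "j div 2 < 2" "i mod 2 < 2" "j mod 2 < 2"
    using assms(3,4) by auto
  ultimately show ?thesis
    using assms(2-4)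
    by (auto simp: rho_AB_def rho_BC_def rho_AC_def ptrace_A_def ptrace_B_def ptrace_C_def k
        simp del: sum.lessThan_Suc intro!: sum.cong)
qed

lemma Lambda_mat_is_trace:
  assumes "\<psi> \<in> carrier_vec 8" "\<rho> \<in> {rho_AB \<psi>, rho_BC \<psi>, rho_AC \<psi>}" "\<alpha> < 4" "\<beta> < 4"
  shows "complex_of_real (Lambda_mat \<rho> $$ (\<alpha>, \<beta>)) = mtrace (\<rho> * kron (pauli \<alpha>) (pauli \<beta>))"
proof -
  have d: "\<rho> \<in> carrier_mat 4 4"
    using assms(2) by (auto simp: rho_AB_def rho_BC_def rho_AC_def ptrace_A_def ptrace_B_def ptrace_C_def)
  have k: "kron (pauli \<alpha>) (pauli \<beta>) \<in> carrier_mat 4 4"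
    using pauli_carrier[OF assms(3)] pauli_carrier[OF assms(4)] by (auto simp: kron_def)
  have "cnj (kron (pauli \<alpha>) (pauli \<beta>) $$ (i, j)) = kron (pauli \<alpha>) (pauli \<beta>) $$ (j, i)"
    if "i < 4" "j < 4" for i j
  proof -
    have "i div 2 < 2" "j div 2 < 2" using that by auto
    then show ?thesis
      using pauli_carrier[OF assms(3)] pauli_carrier[OF assms(4)] that
      by (simp add: kron_def pauli_hermitian assms(3,4))
  qed
  then have "mtrace (\<rho> * kron (pauli \<alpha>) (pauli \<beta>)) \<in> \<real>"
    by (intro mtrace_mult_real[OF d k]) (auto intro: rho_hermitian[OF assms(1,2)])
  then show ?thesis
    using assms(3,4) by (simp add: Lambda_mat_def)
qed

end

theory Submission
  imports Defs
begin

text \<open>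
  In the basis of matrix units instead of Pauli matrices (a similarity by \<open>W_mat\<close>), the
  matrix \<open>\<Gamma>\<close> of \<open>\<Sum>\<^sub>c |M\<^sub>c\<rangle>\<langle>M\<^sub>c|\<close> (two 2 x 2 coefficient matrices \<open>M\<^sub>0\<close>, \<open>M\<^sub>1\<close>, one for each value
  of the traced-out qubit) is \<open>4 \<Sum>\<^sub>c\<^sub>d Q\<^sub>c\<^sub>d \<otimes> cnj Q\<^sub>c\<^sub>d\<close> with \<open>Q\<^sub>c\<^sub>d = \<epsilon> M\<^sub>c \<epsilon> M\<^sub>d\<^sup>T\<close>. Here \<open>Q\<^sub>0\<^sub>0\<close> and \<open>Q\<^sub>1\<^sub>1\<close>
  are scalar and \<open>Q\<^sub>0\<^sub>1\<close>, \<open>Q\<^sub>1\<^sub>0\<close> are adjugates of each other, so with \<open>R = Q\<^sub>0\<^sub>1 - Q\<^sub>1\<^sub>0\<close>, which is traceless,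
  \<open>\<Gamma>\<close> becomes \<open>\<alpha> I + 2 R \<otimes> cnj R\<close>. As \<open>R\<close> squares to the scalar \<open>D\<close> (Cayley's hyperdeterminant of the
  state), the eigenvalues are \<open>\<alpha> \<plusminus> 2 |D|\<close>, each of multiplicity two.
\<close>

section \<open>Entries and determinants of 4 x 4 matrices\<close>

lemma less4: "(i::nat) < 4 \<longleftrightarrow> i = 0 \<or> i = 1 \<or> i = 2 \<or> i = 3" by auto

lemma sum_lessThan4: "(\<Sum>i<4. f i) = f 0 + f 1 + f 2 + (f (3::nat) :: 'a::comm_monoid_add)"
  by (simp add: eval_nat_numeral)

lemma sum_lessThan2: "(\<Sum>i<2. f i) = f 0 + (f (1::nat) :: 'a::comm_monoid_add)"
  by (simp add: eval_nat_numeral)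

lemma index_mult_mat4:
  assumes "A \<in> carrier_mat 4 4" "B \<in> carrier_mat 4 4" "i < 4" "j < 4"
  shows "(A * B) $$ (i, j) = A $$ (i, 0) * B $$ (0, j) + A $$ (i, 1) * B $$ (1, j)
       + A $$ (i, 2) * B $$ (2, j) + A $$ (i, 3) * B $$ (3, j)"
  using assms by (simp add: scalar_prod_def lessThan_atLeast0[symmetric] sum_lessThan4)

lemma eq_mat4I:
  assumes "A \<in> carrier_mat 4 4" "B \<in> carrier_mat 4 4"
    and "\<And>i j. i \<in> {0, 1, 2, 3} \<Longrightarrow> j \<in> {0, 1, 2, 3} \<Longrightarrow> A $$ (i, j) = B $$ (i, j)"
  shows "A = B"
  using assms by (intro eq_matI) (auto simp: less4)

text \<open>Spelled out so that a characteristic polynomial at a point becomes a polynomial in the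
  entries.\<close>

lemma det4:
  fixes A :: "'a::comm_ring_1 mat"
  assumes A: "A \<in> carrier_mat 4 4"
  shows "det A =
     A $$ (0,0) * (A $$ (1,1) * (A $$ (2,2) * A $$ (3,3) - A $$ (2,3) * A $$ (3,2))
                 - A $$ (1,2) * (A $$ (2,1) * A $$ (3,3) - A $$ (2,3) * A $$ (3,1))
                 + A $$ (1,3) * (A $$ (2,1) * A $$ (3,2) - A $$ (2,2) * A $$ (3,1)))
   - A $$ (0,1) * (A $$ (1,0) * (A $$ (2,2) * A $$ (3,3) - A $$ (2,3) * A $$ (3,2))
                 - A $$ (1,2) * (A $$ (2,0) * A $$ (3,3) - A $$ (2,3) * A $$ (3,0))
                 + A $$ (1,3) * (A $$ (2,0) * A $$ (3,2) - A $$ (2,2) * A $$ (3,0)))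
   + A $$ (0,2) * (A $$ (1,0) * (A $$ (2,1) * A $$ (3,3) - A $$ (2,3) * A $$ (3,1))
                 - A $$ (1,1) * (A $$ (2,0) * A $$ (3,3) - A $$ (2,3) * A $$ (3,0))
                 + A $$ (1,3) * (A $$ (2,0) * A $$ (3,1) - A $$ (2,1) * A $$ (3,0)))
   - A $$ (0,3) * (A $$ (1,0) * (A $$ (2,1) * A $$ (3,2) - A $$ (2,2) * A $$ (3,1))
                 - A $$ (1,1) * (A $$ (2,0) * A $$ (3,2) - A $$ (2,2) * A $$ (3,0))
                 + A $$ (1,2) * (A $$ (2,0) * A $$ (3,1) - A $$ (2,1) * A $$ (3,0)))"
proof -
  have det2: "det B = B $$ (0,0) * B $$ (1,1) - B $$ (0,1) * B $$ (1,0)"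
    if "B \<in> carrier_mat 2 2" for B :: "'a mat"
    using that mat_delete_carrier[OF that, of 0]
    by (simp add: laplace_expansion_row[OF that, of 0] cofactor_def det_single eval_nat_numeral mat_delete_def)
  have det3: "det B = B $$ (0,0) * (B $$ (1,1) * B $$ (2,2) - B $$ (1,2) * B $$ (2,1))
     - B $$ (0,1) * (B $$ (1,0) * B $$ (2,2) - B $$ (1,2) * B $$ (2,0))
     + B $$ (0,2) * (B $$ (1,0) * B $$ (2,1) - B $$ (1,1) * B $$ (2,0))"
    if B: "B \<in> carrier_mat 3 3" for B :: "'a mat"
  proof -
    have "mat_delete B 0 j \<in> carrier_mat 2 2" for j
      using mat_delete_carrier[OF B, of 0 j] by simp
    note d = det2[OF this]
    have "det B = (\<Sum>j<3. B $$ (0, j) * cofactor B 0 j)"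
      by (rule laplace_expansion_row[OF B]) simp
    also have "\<dots> = B $$ (0,0) * cofactor B 0 0 + B $$ (0,1) * cofactor B 0 1 + B $$ (0,2) * cofactor B 0 2"
      by (simp add: eval_nat_numeral)
    finally show ?thesis
      using carrier_matD[OF B] by (simp only: cofactor_def d) (simp add: mat_delete_def numeral_2_eq_2 algebra_simps)
  qed
  have "mat_delete A 0 j \<in> carrier_mat 3 3" for j
    using mat_delete_carrier[OF A, of 0 j] by simp
  note d = det3[OF this]
  have "det A = (\<Sum>j<4. A $$ (0, j) * cofactor A 0 j)"
    by (rule laplace_expansion_row[OF A]) simp
  then show ?thesis
    using carrier_matD[OF A]
    by (simp only: sum_lessThan4 cofactor_def d) (simp add: mat_delete_def numeral_2_eq_2 numeral_3_eq_3 algebra_simps)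
qed

section \<open>From the Pauli basis to matrix units\<close>

text \<open>The columns of \<open>W_mat\<close> are the transposed Pauli matrices, read row by row.\<close>

definition W_mat :: "complex mat" where
  "W_mat = mat 4 4 (\<lambda>(i, j).
     [[1, 0, 0, 1], [0, 1, \<i>, 0], [0, 1, - \<i>, 0], [1, 0, 0, - 1]] ! i ! j)"

text \<open>The Kronecker square of \<open>\<epsilon> = ((0, 1), (-1, 0))\<close>.\<close>

definition E_mat :: "complex mat" where
  "E_mat = mat 4 4 (\<lambda>(i, j).
     [[0, 0, 0, 1], [0, 0, - 1, 0], [0, - 1, 0, 0], [1, 0, 0, 0]] ! i ! j)"

text \<open>The realignment (reshuffling) of a two-qubit operator: rows carry both indices of the
  first qubit, columns both indices of the second.\<close>

definition realign :: "complex mat \<Rightarrow> complex mat" where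
  "realign \<rho> = mat 4 4 (\<lambda>(p, q). \<rho> $$ (2 * (p div 2) + q div 2, 2 * (p mod 2) + q mod 2))"

lemma W_carrier [simp]: "W_mat \<in> carrier_mat 4 4" "dim_row W_mat = 4" "dim_col W_mat = 4"
  by (auto simp: W_mat_def)

lemma E_carrier [simp]: "E_mat \<in> carrier_mat 4 4" "dim_row E_mat = 4" "dim_col E_mat = 4"
  by (auto simp: E_mat_def)

lemma realign_carrier [simp]: "realign \<rho> \<in> carrier_mat 4 4" "dim_row (realign \<rho>) = 4" "dim_col (realign \<rho>) = 4"
  by (auto simp: realign_def)

lemma Lambda_carrier [simp]: "Lambda_mat \<rho> \<in> carrier_mat 4 4"
  by (auto simp: Lambda_mat_def)

lemma G_carrier [simp]: "G_mat \<in> carrier_mat 4 4"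
  by (auto simp: G_mat_def)

lemma Gamma_carrier [simp]: "Gamma_mat \<rho> \<in> carrier_mat 4 4"
  by (simp add: Gamma_mat_def mult_carrier_mat[of _ 4 4])

lemma mtrace_kron_pauli:
  assumes "\<rho> \<in> carrier_mat 4 4" "P \<in> carrier_mat 2 2" "Q \<in> carrier_mat 2 2"
  shows "mtrace (\<rho> * kron P Q) =
    (\<Sum>i<4. \<Sum>j<4. \<rho> $$ (i, j) * (P $$ (j div 2, i div 2) * Q $$ (j mod 2, i mod 2)))"
  using assms by (auto simp: mtrace_def scalar_prod_def kron_def lessThan_atLeast0 intro!: sum.cong)

text \<open>The trace of \<open>\<rho>\<close> against a Kronecker product of P and Q is the
  bilinear form of \<open>realign \<rho>\<close> on the transposes of P and Q. Hermiticity makes it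
  real, which disposes of the \<open>Re\<close> in \<open>Lambda_mat\<close>.\<close>

lemma Lambda_mat_realign:
  assumes "\<psi> \<in> carrier_vec 8" "\<rho> \<in> {rho_AB \<psi>, rho_BC \<psi>, rho_AC \<psi>}"
  shows "map_mat complex_of_real (Lambda_mat \<rho>) = transpose_mat W_mat * (realign \<rho> * W_mat)"
proof (rule eq_mat4I)
  fix i j :: nat assume ij: "i \<in> {0,1,2,3}" "j \<in> {0,1,2,3}"
  have d: "\<rho> \<in> carrier_mat 4 4"
    using assms(2) by (auto simp: rho_AB_def rho_BC_def rho_AC_def ptrace_A_def ptrace_B_def ptrace_C_def)
  have lt: "i < 4" "j < 4" using ij by auto
  have "map_mat complex_of_real (Lambda_mat \<rho>) $$ (i, j) =
     complex_of_real (Lambda_mat \<rho> $$ (i, j))"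
    using lt by (auto simp: Lambda_mat_def)
  also have "\<dots> = (\<Sum>k<4. \<Sum>l<4. \<rho> $$ (k, l) * (pauli i $$ (l div 2, k div 2) * pauli j $$ (l mod 2, k mod 2)))"
    by (simp only: Lambda_mat_is_trace[OF assms lt] mtrace_kron_pauli[OF d pauli_carrier[OF lt(1)] pauli_carrier[OF lt(2)]])
  also have "\<dots> = (transpose_mat W_mat * (realign \<rho> * W_mat)) $$ (i, j)"
    using ij
    by (auto simp: index_mult_mat4 mult_carrier_mat[of _ 4 4] sum_lessThan4 simp del: index_mult_mat(1),
        auto simp: pauli_def W_mat_def mat_of_rows_list_def realign_def algebra_simps,
        auto simp: numeral_2_eq_2 numeral_3_eq_3)
  finally show "map_mat complex_of_real (Lambda_mat \<rho>) $$ (i, j) = (transpose_mat W_mat * (realign \<rho> * W_mat)) $$ (i, j)" .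
qed auto

text \<open>The determinant of a 2 x 2 matrix is the Minkowski form \<open>G_mat\<close> in Pauli
  coordinates and half of \<open>E_mat\<close> in matrix units. Both matrices are their own
  inverses, so the dual forms correspond too, which is this identity.\<close>

lemma W_G_W: "W_mat * map_mat complex_of_real G_mat * transpose_mat W_mat = 2 \<cdot>\<^sub>m E_mat"
  by (rule eq_mat4I)
     (auto simp: index_mult_mat4 mult_carrier_mat[of _ 4 4] simp del: index_mult_mat(1),
      auto simp: W_mat_def E_mat_def G_mat_def mat_diag_def)


lemma char_poly_Gamma_mat:
  assumes "map_mat complex_of_real (Lambda_mat \<rho>) = transpose_mat W_mat * (realign \<rho> * W_mat)"
  shows "char_poly (map_mat complex_of_real (Gamma_mat \<rho>))
    = char_poly (4 \<cdot>\<^sub>m (E_mat * realign \<rho> * E_mat * transpose_mat (realign \<rho>)))"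
proof (rule char_poly_similar[OF similar_matI])
  define W G K where "W = W_mat" "G = map_mat complex_of_real G_mat" "K = realign \<rho>"
  \<comment> \<open>The Pauli matrices are orthogonal with squared Hilbert-Schmidt norm 2, so the
    inverse of \<open>W\<close> is half its conjugate transpose.\<close>
  define V where "V = mat 4 4 (\<lambda>(i, j). cnj (W $$ (j, i)) / 2)"
  note c = W_G_K_def V_def
  have C [simp]: "W \<in> carrier_mat 4 4" "G \<in> carrier_mat 4 4" "K \<in> carrier_mat 4 4" "V \<in> carrier_mat 4 4"
    by (auto simp: c)
  note m = mult_carrier_mat[of _ 4 4 _ 4]
  show VW: "V * W = 1\<^sub>m 4"
    by (rule eq_mat4I)
      (auto simp: index_mult_mat4 c simp del: index_mult_mat(1), auto simp: W_mat_def)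
  show "W * V = 1\<^sub>m 4"
    by (rule eq_mat4I)
      (auto simp: index_mult_mat4 c simp del: index_mult_mat(1), auto simp: W_mat_def)
  have WGW: "W * (G * (transpose_mat W * X)) = 2 \<cdot>\<^sub>m (E_mat * X)" if "X \<in> carrier_mat 4 4" for X
  proof -
    have "W * (G * (transpose_mat W * X)) = (W * G * transpose_mat W) * X"
      using that by (simp add: assoc_mult_mat[of _ 4 4 _ 4 _ 4] m)
    then show ?thesis
      using that by (simp add: c W_G_W mult_smult_assoc_mat[of _ 4 4 _ 4])
  qed
  have VWX: "V * (W * X) = X" if "X \<in> carrier_mat 4 4" for X
    using that VW by (simp add: assoc_mult_mat[of _ 4 4 _ 4 _ 4, symmetric])
  have smult4: "2 \<cdot>\<^sub>m (2 \<cdot>\<^sub>m X) = 4 \<cdot>\<^sub>m X" for X :: "complex mat"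
    by (rule eq_matI) auto
  have L: "map_mat complex_of_real (Lambda_mat \<rho>) = transpose_mat W * (K * W)"
    using assms by (simp add: c)
  have LT: "transpose_mat (transpose_mat W * (K * W)) = transpose_mat W * (transpose_mat K * W)"
    by (simp add: transpose_mult[of _ 4 4 _ 4] m assoc_mult_mat[of _ 4 4 _ 4 _ 4])
  have "map_mat complex_of_real (Gamma_mat \<rho>)
     = G * (transpose_mat W * (K * W)) * G * transpose_mat (transpose_mat W * (K * W))"
    unfolding L[symmetric] unfolding Gamma_mat_def c
    by (simp add: of_real_hom.mat_hom_mult[of _ 4 4 _ 4] m map_mat_transpose)
  also have "\<dots> = G * (transpose_mat W * (K * (W * (G * (transpose_mat W * (transpose_mat K * W))))))"
    unfolding LT by (simp add: assoc_mult_mat[of _ 4 4 _ 4 _ 4] m)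
  \<comment> \<open>With \<open>V * W\<close> inserted on the left, each \<open>G\<close> stands
    between \<open>W\<close> and its transpose and can be replaced by \<open>WGW\<close>.\<close>
  also have "\<dots> = V * (W * (G * (transpose_mat W * (K * (W * (G * (transpose_mat W * (transpose_mat K * W))))))))"
    by (simp add: VWX m)
  also have "\<dots> = V * (4 \<cdot>\<^sub>m (E_mat * K * E_mat * transpose_mat K)) * W"
    by (simp add: WGW m assoc_mult_mat[of _ 4 4 _ 4 _ 4] mult_smult_assoc_mat[of _ 4 4 _ 4]
        mult_smult_distrib[of _ 4 4 _ 4] smult4)
  finally show "map_mat complex_of_real (Gamma_mat \<rho>)
      = V * (4 \<cdot>\<^sub>m (E_mat * realign \<rho> * E_mat * transpose_mat (realign \<rho>))) * W"
    by (simp add: c)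
  show "{map_mat complex_of_real (Gamma_mat \<rho>),
      4 \<cdot>\<^sub>m (E_mat * realign \<rho> * E_mat * transpose_mat (realign \<rho>)), V, W} \<subseteq> carrier_mat 4 4"
    by (simp add: m)
qed

section \<open>A scalar plus a Kronecker square\<close>

text \<open>The traceless R = ((u, v), (w, -u)) squares to \<open>D\<close>, so R \<otimes> cnj R
  has trace 0 and squares to |D|^2: its eigenvalues are |D| and -|D|, twice each.\<close>

lemma char_poly_traceless_kron:
  fixes \<alpha> u v w :: complex
  defines "D \<equiv> u\<^sup>2 + v * w"
  assumes A: "A \<in> carrier_mat 4 4"
    and Aij: "\<And>i j. i \<in> {0,1,2,3} \<Longrightarrow> j \<in> {0,1,2,3} \<Longrightarrow> A $$ (i, j) = (if i = j then \<alpha> else 0)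
      + [[u, v], [w, - u]] ! (i div 2) ! (j div 2) * cnj ([[u, v], [w, - u]] ! (i mod 2) ! (j mod 2))"
  shows "char_poly A = (\<Prod>\<mu>\<leftarrow>[\<alpha> + cmod D, \<alpha> + cmod D, \<alpha> - cmod D, \<alpha> - cmod D]. [:- \<mu>, 1:])"
proof -
  \<comment> \<open>Treating the conjugates as independent letters turns the determinant below into
    an ordinary polynomial identity.\<close>
  define U V' W' where "U = cnj u" "V' = cnj v" "W' = cnj w"
  note c = this
  have "poly (char_poly A) x = poly (\<Prod>\<mu>\<leftarrow>[\<alpha> + cmod D, \<alpha> + cmod D, \<alpha> - cmod D, \<alpha> - cmod D]. [:- \<mu>, 1:]) x" for x
  proof -
    define y where "y = x - \<alpha>"
    have x: "x = y + \<alpha>" by (simp add: y_def)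
    have "poly (char_poly A) x = det (- (char_matrix A x))"
      by (rule char_poly_matrix[OF A])
    also have "\<dots> = (y\<^sup>2 - (u\<^sup>2 + v * w) * (U\<^sup>2 + V' * W'))\<^sup>2"
      using carrier_matD[OF A]
      by (simp add: det4 char_matrix_def Aij A c[symmetric] x) (simp add: algebra_simps power2_eq_square)
    also have "(u\<^sup>2 + v * w) * (U\<^sup>2 + V' * W') = (of_real (cmod D))\<^sup>2"
      using complex_norm_square[of D] by (simp add: c D_def)
    finally show ?thesis
      by (simp add: x algebra_simps power2_eq_square)
  qed
  then show ?thesis
    by (simp add: poly_eq_poly_eq_iff[symmetric] fun_eq_iff del: prod_list.Cons)
qed


section \<open>Invariants of a 2 x 2 x 2 array of amplitudes\<close>

definition two_qubit_mixture :: "(nat \<Rightarrow> nat \<Rightarrow> nat \<Rightarrow> complex) \<Rightarrow> complex mat" where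
  "two_qubit_mixture M = mat 4 4 (\<lambda>(i, j).
     \<Sum>c<2. M c (i div 2) (i mod 2) * cnj (M c (j div 2) (j mod 2)))"

definition slice_det :: "(nat \<Rightarrow> nat \<Rightarrow> nat \<Rightarrow> complex) \<Rightarrow> nat \<Rightarrow> complex" where
  "slice_det M c = M c 0 0 * M c 1 1 - M c 0 1 * M c 1 0"

text \<open>The coefficient of x y in det (x M_0 + y M_1), whose outer coefficients are the values
  of \<open>slice_det\<close>.\<close>

definition mixed_det :: "(nat \<Rightarrow> nat \<Rightarrow> nat \<Rightarrow> complex) \<Rightarrow> complex" where
  "mixed_det M = M 0 0 0 * M 1 1 1 + M 1 0 0 * M 0 1 1 - M 0 0 1 * M 1 1 0 - M 1 0 1 * M 0 1 0"

definition mean_ev :: "(nat \<Rightarrow> nat \<Rightarrow> nat \<Rightarrow> complex) \<Rightarrow> real" where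
  "mean_ev M = 4 * ((cmod (slice_det M 0))\<^sup>2 + (cmod (slice_det M 1))\<^sup>2) + 2 * (cmod (mixed_det M))\<^sup>2"

text \<open>The discriminant of that binary quadratic form.\<close>

definition hyperdet :: "(nat \<Rightarrow> nat \<Rightarrow> nat \<Rightarrow> complex) \<Rightarrow> complex" where
  "hyperdet M = (mixed_det M)\<^sup>2 - 4 * slice_det M 0 * slice_det M 1"

text \<open>Realignment turns |M_c><M_c| into M_c \<otimes> cnj M_c, and such products multiply
  factorwise.\<close>

lemma realign_mixture_index:
  assumes "p < 4" "q < 4"
  shows "realign (two_qubit_mixture M) $$ (p, q) =
    M 0 (p div 2) (q div 2) * cnj (M 0 (p mod 2) (q mod 2)) + M 1 (p div 2) (q div 2) * cnj (M 1 (p mod 2) (q mod 2))"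
proof -
  have "2 * (p div 2) + q div 2 < 4" "2 * (p mod 2) + q mod 2 < 4" "q div 2 < 2"
    using assms by (auto simp: less4)
  then show ?thesis
    using assms by (simp add: realign_def two_qubit_mixture_def sum_lessThan2)
qed

text \<open>With m = \<open>mixed_det M\<close>, the sum of \<open>Q\<^sub>0\<^sub>1\<close> and
  \<open>Q\<^sub>1\<^sub>0\<close> is -m I, so they are (-m I + R)/2 and (-m I - R)/2. Adding their
  Kronecker squares Q \<otimes> cnj Q cancels the cross terms and leaves (|m|^2 I + R \<otimes> cnj
  R)/2.\<close>

lemma char_poly_mixture:
  fixes M
  defines "K \<equiv> realign (two_qubit_mixture M)"
  defines "p \<equiv> complex_of_real (mean_ev M + 2 * cmod (hyperdet M))"
    and "q \<equiv> complex_of_real (mean_ev M - 2 * cmod (hyperdet M))"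
  shows "char_poly (4 \<cdot>\<^sub>m (E_mat * K * E_mat * transpose_mat K)) = (\<Prod>\<mu>\<leftarrow>[p, p, q, q]. [:- \<mu>, 1:])"
proof -
  \<comment> \<open>\<open>r\<close> absorbs the factor 2 in front of \<open>R \<otimes> cnj R\<close>.\<close>
  define r :: complex where "r = of_real (sqrt 2)"
  have r: "r * r = 2" "cnj r = r"
    by (simp_all add: r_def flip: of_real_mult)
  have r': "r * (r * z) = 2 * z" for z
    using r(1) by (simp add: mult.assoc[symmetric])
  \<comment> \<open>The entries of \<open>r\<close> times R.\<close>
  define u v w where
    "u = r * (M 1 1 1 * M 0 0 0 - M 0 1 1 * M 1 0 0 + M 0 1 0 * M 1 0 1 - M 1 1 0 * M 0 0 1)"
    "v = r * (2 * (M 0 1 0 * M 1 1 1 - M 0 1 1 * M 1 1 0))"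
    "w = r * (2 * (M 1 0 0 * M 0 0 1 - M 0 0 0 * M 1 0 1))"
  define D where "D = u\<^sup>2 + v * w"
  \<comment> \<open>R^2 is the square of \<open>Q\<^sub>0\<^sub>1 + Q\<^sub>1\<^sub>0\<close> minus
    4 \<open>Q\<^sub>0\<^sub>1 Q\<^sub>1\<^sub>0\<close>, and this last product is the scalar
    \<open>slice_det M 0 * slice_det M 1\<close>.\<close>
  have "D = 2 * hyperdet M"
    unfolding D_def u_v_w_def hyperdet_def slice_det_def mixed_det_def
    by (simp add: algebra_simps power2_eq_square r r')
  then have D: "cmod D = 2 * cmod (hyperdet M)"
    by (simp add: norm_mult)
  have \<alpha>: "complex_of_real (mean_ev M) = 4 * (slice_det M 0 * cnj (slice_det M 0)
      + slice_det M 1 * cnj (slice_det M 1)) + 2 * (mixed_det M * cnj (mixed_det M))"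
    unfolding mean_ev_def of_real_add of_real_mult complex_norm_square by simp
  have "char_poly (4 \<cdot>\<^sub>m (E_mat * K * E_mat * transpose_mat K))
    = (\<Prod>\<mu>\<leftarrow>[of_real (mean_ev M) + of_real (cmod D), of_real (mean_ev M) + of_real (cmod D),
        of_real (mean_ev M) - of_real (cmod D), of_real (mean_ev M) - complex_of_real (cmod D)]. [:- \<mu>, 1:])"
    unfolding D_def
  proof (rule char_poly_traceless_kron)
    show "4 \<cdot>\<^sub>m (E_mat * K * E_mat * transpose_mat K) \<in> carrier_mat 4 4"
      by (simp add: K_def mult_carrier_mat[of _ 4 4])
    fix i j :: nat assume "i \<in> {0,1,2,3}" "j \<in> {0,1,2,3}"
    then show "(4 \<cdot>\<^sub>m (E_mat * K * E_mat * transpose_mat K)) $$ (i, j) =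
        (if i = j then of_real (mean_ev M) else 0)
         + [[u, v], [w, - u]] ! (i div 2) ! (j div 2) * cnj ([[u, v], [w, - u]] ! (i mod 2) ! (j mod 2))"
      unfolding \<alpha>
      by (auto simp: K_def index_mult_mat4 mult_carrier_mat[of _ 4 4] simp del: index_mult_mat(1),
          auto simp: E_mat_def realign_mixture_index,
          auto simp: u_v_w_def slice_det_def mixed_det_def r r' algebra_simps)
  qed
  then show ?thesis
    by (simp add: p_def q_def D)
qed


section \<open>Real eigenvalues for pure states and for the canonical form\<close>

lemma char_poly_Gamma_mat_mixture:
  assumes "\<psi> \<in> carrier_vec 8" "\<rho> \<in> {rho_AB \<psi>, rho_BC \<psi>, rho_AC \<psi>}" "\<rho> = two_qubit_mixture M"
  defines "p \<equiv> mean_ev M + 2 * cmod (hyperdet M)" and "q \<equiv> mean_ev M - 2 * cmod (hyperdet M)"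
  shows "char_poly (Gamma_mat \<rho>) = (\<Prod>\<mu>\<leftarrow>[p, p, q, q]. [:- \<mu>, 1:])"
    and "spectrum (map_mat complex_of_real (Gamma_mat \<rho>)) \<subseteq> {complex_of_real p, complex_of_real q}"
proof -
  let ?P = "\<lambda>p q. \<Prod>\<mu>\<leftarrow>[p, p, q, q]. [:- \<mu>, 1:]"
  have c: "char_poly (map_mat complex_of_real (Gamma_mat \<rho>)) = ?P (of_real p) (of_real q)"
    unfolding char_poly_Gamma_mat[OF Lambda_mat_realign[OF assms(1,2)]] p_def q_def
    unfolding assms(3) by (rule char_poly_mixture)
  \<comment> \<open>The factorization holds over the complex numbers; injectivity of the coefficient
    embedding brings it back to the reals.\<close>
  interpret R: map_poly_inj_comm_ring_hom complex_of_real ..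
  have "map_poly complex_of_real (char_poly (Gamma_mat \<rho>)) = map_poly of_real (?P p q)"
    unfolding of_real_hom.char_poly_hom[OF Gamma_carrier, symmetric] c
    by (simp add: of_real_hom.map_poly_pCons_hom hom_distribs)
  then show "char_poly (Gamma_mat \<rho>) = ?P p q"
    by (simp only: R.eq_iff)
  have C: "map_mat complex_of_real (Gamma_mat \<rho>) \<in> carrier_mat 4 4" by simp
  show "spectrum (map_mat complex_of_real (Gamma_mat \<rho>)) \<subseteq> {complex_of_real p, complex_of_real q}"
    unfolding spectrum_root_char_poly[OF C] c by (auto simp: poly_mult simp del: mult_pCons_left mult_pCons_right)
qed

lemma rho_eq_mixture:
  assumes "\<psi> \<in> carrier_vec 8"
  shows "rho_AB \<psi> = two_qubit_mixture (\<lambda>c a b. \<psi> $ idx3 a b c)"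
    and "rho_BC \<psi> = two_qubit_mixture (\<lambda>a b c. \<psi> $ idx3 a b c)"
    and "rho_AC \<psi> = two_qubit_mixture (\<lambda>b a c. \<psi> $ idx3 a b c)"
proof -
  have "ket_bra \<psi> $$ (idx3 a b c, idx3 a' b' c') = \<psi> $ idx3 a b c * cnj (\<psi> $ idx3 a' b' c')"
    if "a < 2" "b < 2" "c < 2" "a' < 2" "b' < 2" "c' < 2" for a b c a' b' c'
    using assms that by (auto simp: ket_bra_def idx3_def)
  note k = this
  have d: "i div 2 < 2" if "i < 4" for i :: nat using that by auto
  show "rho_AB \<psi> = two_qubit_mixture (\<lambda>c a b. \<psi> $ idx3 a b c)"
    "rho_BC \<psi> = two_qubit_mixture (\<lambda>a b c. \<psi> $ idx3 a b c)"
    "rho_AC \<psi> = two_qubit_mixture (\<lambda>b a c. \<psi> $ idx3 a b c)"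
    by (auto simp: rho_AB_def rho_BC_def rho_AC_def ptrace_A_def ptrace_B_def ptrace_C_def
        two_qubit_mixture_def k d intro!: sum.cong simp del: sum.lessThan_Suc)
qed

lemma canonical_state_entries:
  assumes "a < 2" "b < 2" "c < 2"
  shows "canonical_state l \<phi> $ idx3 a b c =
    (if a = 0 then if b = 0 \<and> c = 0 then complex_of_real (l 0) else 0
     else if b = 0 then if c = 0 then complex_of_real (l 1) * exp (\<i> * complex_of_real \<phi>) else complex_of_real (l 2)
     else if c = 0 then complex_of_real (l 3) else complex_of_real (l 4))"
  using assms by (auto simp: canonical_state_def ket3_def idx3_def less_2_cases_iff)

theorem mainTheorem2:
  fixes \<psi> :: "complex vec"
  assumes "pure_state3 \<psi>"
  shows "(\<forall>\<rho> \<in> {rho_AB \<psi>, rho_BC \<psi>, rho_AC \<psi>}.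
            card (spectrum (map_mat complex_of_real (Gamma_mat \<rho>))) \<le> 2)
       \<and> (\<forall>(l :: nat \<Rightarrow> real) (\<phi> :: real).
            (\<forall>k\<le>4. 0 \<le> l k) \<and> (\<Sum>k\<le>4. (l k)\<^sup>2) = 1 \<and> 0 \<le> \<phi> \<and> \<phi> \<le> pi
            \<and> \<psi> = canonical_state l \<phi> \<longrightarrow>
            (let A1 = 4 * (l 0)\<^sup>2 * ((l 3)\<^sup>2 + (l 4)\<^sup>2); A2 = 4 * (l 0)\<^sup>2 * (l 3)\<^sup>2;
                 B1 = 4 * (Delta l \<phi> + (l 0)\<^sup>2 * (l 4)\<^sup>2); B2 = 4 * Delta l \<phi>;
                 C1 = 4 * (l 0)\<^sup>2 * ((l 2)\<^sup>2 + (l 4)\<^sup>2); C2 = 4 * (l 0)\<^sup>2 * (l 2)\<^sup>2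
             in eigenvalues_with_mult (Gamma_mat (rho_AB \<psi>)) [A1, A1, A2, A2]
              \<and> eigenvalues_with_mult (Gamma_mat (rho_BC \<psi>)) [B1, B1, B2, B2]
              \<and> eigenvalues_with_mult (Gamma_mat (rho_AC \<psi>)) [C1, C1, C2, C2]))"
proof (intro conjI ballI allI impI)
  have \<psi>: "\<psi> \<in> carrier_vec 8"
    using assms by (simp add: pure_state3_def)
  note rho = rho_eq_mixture[OF \<psi>]
  fix \<rho> assume \<rho>: "\<rho> \<in> {rho_AB \<psi>, rho_BC \<psi>, rho_AC \<psi>}"
  then obtain M where "\<rho> = two_qubit_mixture M"
    using rho by auto
  from card_mono[OF _ char_poly_Gamma_mat_mixture(2)[OF \<psi> \<rho> this]]
  show "card (spectrum (map_mat complex_of_real (Gamma_mat \<rho>))) \<le> 2"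
    by (rule order_trans) (auto simp: card_insert_if)
next
  have \<psi>: "\<psi> \<in> carrier_vec 8"
    using assms by (simp add: pure_state3_def)
  note rho = rho_eq_mixture[OF \<psi>]
  note cp = char_poly_Gamma_mat_mixture(1)[OF \<psi> _ rho(1)] char_poly_Gamma_mat_mixture(1)[OF \<psi> _ rho(2)]
    char_poly_Gamma_mat_mixture(1)[OF \<psi> _ rho(3)]
  fix l :: "nat \<Rightarrow> real" and \<phi> :: real
  assume h: "(\<forall>k\<le>4. 0 \<le> l k) \<and> (\<Sum>k\<le>4. (l k)\<^sup>2) = 1 \<and> 0 \<le> \<phi> \<and> \<phi> \<le> pi \<and> \<psi> = canonical_state l \<phi>"
  then have \<psi>l: "\<psi> = canonical_state l \<phi>" by simp
  define M\<^sub>A M\<^sub>B M\<^sub>C where M: "M\<^sub>A = (\<lambda>a b c. \<psi> $ idx3 a b c)" "M\<^sub>B = (\<lambda>b a c. \<psi> $ idx3 a b c)" "M\<^sub>C = (\<lambda>c a b. \<psi> $ idx3 a b c)"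
  have "mixed_det M\<^sub>C = of_real (l 0 * l 4)" "slice_det M\<^sub>C 0 = of_real (l 0 * l 3)" "slice_det M\<^sub>C 1 = 0"
    "mixed_det M\<^sub>B = of_real (l 0 * l 4)" "slice_det M\<^sub>B 0 = of_real (l 0 * l 2)" "slice_det M\<^sub>B 1 = 0"
    "mixed_det M\<^sub>A = of_real (l 0 * l 4)" "slice_det M\<^sub>A 0 = 0"
    "(cmod (slice_det M\<^sub>A 1))\<^sup>2 = Delta l \<phi>"
    unfolding M \<psi>l mixed_det_def slice_det_def Delta_def
    by (simp_all add: canonical_state_entries algebra_simps)
  note e = this
  show "let A1 = 4 * (l 0)\<^sup>2 * ((l 3)\<^sup>2 + (l 4)\<^sup>2); A2 = 4 * (l 0)\<^sup>2 * (l 3)\<^sup>2;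
                 B1 = 4 * (Delta l \<phi> + (l 0)\<^sup>2 * (l 4)\<^sup>2); B2 = 4 * Delta l \<phi>;
                 C1 = 4 * (l 0)\<^sup>2 * ((l 2)\<^sup>2 + (l 4)\<^sup>2); C2 = 4 * (l 0)\<^sup>2 * (l 2)\<^sup>2
             in eigenvalues_with_mult (Gamma_mat (rho_AB \<psi>)) [A1, A1, A2, A2]
              \<and> eigenvalues_with_mult (Gamma_mat (rho_BC \<psi>)) [B1, B1, B2, B2]
              \<and> eigenvalues_with_mult (Gamma_mat (rho_AC \<psi>)) [C1, C1, C2, C2]"
  proof -
    \<comment> \<open>In every slicing direction one slice determinant vanishes, so the
      hyperdeterminant is \<open>(l 0 * l 4)\<^sup>2\<close>, and \<open>mean_ev M\<close> plus or
      minus twice its modulus is \<open>4 * S + 4 * (l 0)\<^sup>2 * (l 4)\<^sup>2\<close> or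
      \<open>4 * S\<close>.\<close>
    have ev: "mean_ev M = 4 * S + 2 * (l 0)\<^sup>2 * (l 4)\<^sup>2" "cmod (hyperdet M) = (l 0)\<^sup>2 * (l 4)\<^sup>2"
      if "mixed_det M = of_real (l 0 * l 4)" "slice_det M 0 * slice_det M 1 = 0"
        "(cmod (slice_det M 0))\<^sup>2 + (cmod (slice_det M 1))\<^sup>2 = S" for M S
      using that by (auto simp: mean_ev_def hyperdet_def norm_mult norm_power power_mult_distrib)
    have "mean_ev M\<^sub>A = 4 * Delta l \<phi> + 2 * (l 0)\<^sup>2 * (l 4)\<^sup>2" "cmod (hyperdet M\<^sub>A) = (l 0)\<^sup>2 * (l 4)\<^sup>2"
      "mean_ev M\<^sub>B = 4 * ((l 0)\<^sup>2 * (l 2)\<^sup>2) + 2 * (l 0)\<^sup>2 * (l 4)\<^sup>2" "cmod (hyperdet M\<^sub>B) = (l 0)\<^sup>2 * (l 4)\<^sup>2"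
      "mean_ev M\<^sub>C = 4 * ((l 0)\<^sup>2 * (l 3)\<^sup>2) + 2 * (l 0)\<^sup>2 * (l 4)\<^sup>2" "cmod (hyperdet M\<^sub>C) = (l 0)\<^sup>2 * (l 4)\<^sup>2"
      by (rule ev; simp add: e(1-8) e[unfolded One_nat_def] norm_mult power_mult_distrib)+
    then show ?thesis
      unfolding eigenvalues_with_mult_def Let_def
      using cp(1)[folded M] cp(2)[folded M] cp(3)[folded M] by (simp add: algebra_simps)
  qed
qed

end
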